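(* Let $(X_1,\Lambda_1)$ be a solution of the nonlinear eigenvalue problem $A(X_1X_1^H)X_1=X_1\Lambda_1$, $X_1^HX_1=I$, with $\Lambda_1=\mathrm{diag}(\lambda_1,\ldots,\lambda_p)$, let $\lambda_1\le\cdots\le\lambda_n$ be the eigenvalues of $A(X_1X_1^H)$ with $\lambda_{p+1}-\lambda_p\ne 0$, and let $X=[X_1\;X_2]=[x_1\;\cdots\;x_n]$ be unitary with $A(X_1X_1^H)X=X\,\mathrm{diag}(\lambda_1,\ldots,\lambda_n)$. Then the convergence factor $\rho(J_P)$ of the SCF iteration is bounded by $$\rho(J_P)\le\frac{\|L'\|_2}{\delta_{q+1}}+\sum_{(\ell,m)\in\Omega_q}\frac{1}{|\lambda_\ell-\lambda_m|}\,\|\mathcal{L}(S(x_\ell x_m^H))\|_F$$ for any integer $q\in[0,p(n-p)]$, where $\delta_{p(n-p)+1}:=\infty$ (so that the first term is $0$ when $q=p(n-p)$).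
   Context: $M\subset\mathbb{C}^{n\times n}$ is the set of Hermitian matrices, $1\le p<n$. $A:M\to M$ has the form $A(P)=A_0+\mathcal{L}(P)$, where $A_0\in M$ and $\mathcal{L}:\mathbb{C}^{n\times n}\to\mathbb{C}^{n\times n}$ is complex linear. $\rho$ denotes the spectral radius, $\|\cdot\|_2$ the spectral norm and $\|\cdot\|_F$ the Frobenius norm. Gaps: for $j=1,\ldots,p(n-p)$, $\delta_j$ is the $j$-th smallest (counted with multiplicity) of the $p(n-p)$ distances $|\lambda_i-\lambda_k|$ with $i\le p$, $k\ge p+1$; in particular $\delta_1=\lambda_{p+1}-\lambda_p$. $\Omega_q\subset[1,n]\times[1,n]$ is the set of the $2q$ index pairs $(i,k)$ and $(k,i)$, $i\le p<k$, corresponding to the $q$ smallest gaps $\delta_1,\ldots,\delta_q$ (ties broken arbitrarily; $\Omega_0=\emptyset$). $\operatorname{vec}$ is column-stacking vectorization, $\otimes$ the Kronecker product, $\overline{X}$ entrywise complex conjugation. Let $N=n(n+1)/2$. $\operatorname{vech}(W)=[w_{1,1},\ldots,w_{n,1},w_{2,2},\ldots,w_{n,2},w_{3,3},\ldots,w_{n,n}]^T\in\mathbb{C}^{N}$ stacks the columns of the lower triangular part (including the diagonal) of $W\in\mathbb{C}^{n\times n}$; $\operatorname{vech}^{-1}$ maps a vector to the corresponding Hermitian matrix, so for a standard basis vector $e_j$ of $\mathbb{R}^N$, $\operatorname{vech}^{-1}(e_j)$ is the real symmetric matrix whose lower triangular part is given by $e_j$. $T\in\mathbb{R}^{N\times n^2}$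 is the block diagonal matrix $T=\mathrm{diag}(I_n,[0\;I_{n-1}],[0\;0\;I_{n-2}],\ldots,[0\cdots0\;1])$, whose $k$-th block is of size $(n-k+1)\times n$; it satisfies $\operatorname{vech}(W)=T\operatorname{vec}(W)$. The symmetrization operator is $S(W)=\sum_{j=1}^{N}\operatorname{vech}(W)_j\operatorname{vech}^{-1}(e_j)$ for $W\in\mathbb{C}^{n\times n}$; equivalently, if $W=W_L+W_D+W_R$ with $W_L$ strictly lower triangular, $W_D$ diagonal, $W_R$ strictly upper triangular, then $S(W)=W_L+W_D+W_L^T$. $L'=\big(\operatorname{vec}(\mathcal{L}(\operatorname{vech}^{-1}(e_1))),\ldots,\operatorname{vec}(\mathcal{L}(\operatorname{vech}^{-1}(e_N)))\big)\in\mathbb{C}^{n^2\times N}$. The reciprocal gap matrix $R\in\mathbb{R}^{n\times n}$ is $R_{i,j}=\frac{1}{\lambda_j-\lambda_i}$ if $i\le p<j$, $R_{i,j}=\frac{1}{\lambda_i-\lambda_j}$ if $j\le p<i$, and $R_{i,j}=0$ otherwise; $D=\mathrm{diag}(\operatorname{vec}(R))\in\mathbb{R}^{n^2\times n^2}$. The matrix $J_P$ is $$J_P=-T(\overline{X}\otimes X)\,D\,(X^T\otimes X^H)\,L'\in\mathbb{C}^{N\times N},$$ and $\rho(J_P)$ is called the convergence factor of the SCF iteration. *)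

theory Defs
  imports
    "Jordan_Normal_Form.Spectral_Radius"
    "Jordan_Normal_Form.Schur_Decomposition"
    "HOL-Library.Extended_Real"
    "HOL-Library.FuncSet"
    "HOL-Library.Multiset"
begin

text \<open>
  Rows, columns and eigenvalues are numbered from 0, as is usual for \<^typ>\<open>'a mat\<close>: the
  eigenvalues lambda_1, ..., lambda_n are \<open>lam 0\<close>, ..., \<open>lam (n - 1)\<close>, and an index is among the
  first p if it is smaller than p. The gaps delta_1, delta_2, ... keep their numbering from 1.
\<close>

definition hermitian_mats :: "nat \<Rightarrow> complex mat set" where
  "hermitian_mats n = {H \<in> carrier_mat n n. mat_adjoint H = H}"

definition unitary_mat :: "nat \<Rightarrow> complex mat \<Rightarrow> bool" where
  "unitary_mat n U \<longleftrightarrow>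
     U \<in> carrier_mat n n \<and> mat_adjoint U * U = 1\<^sub>m n \<and> U * mat_adjoint U = 1\<^sub>m n"

definition linear_on_mats :: "nat \<Rightarrow> (complex mat \<Rightarrow> complex mat) \<Rightarrow> bool" where
  "linear_on_mats n L \<longleftrightarrow>
     L \<in> carrier_mat n n \<rightarrow> carrier_mat n n \<and>
     (\<forall>U \<in> carrier_mat n n. \<forall>V \<in> carrier_mat n n. L (U + V) = L U + L V) \<and>
     (\<forall>c. \<forall>U \<in> carrier_mat n n. L (c \<cdot>\<^sub>m U) = c \<cdot>\<^sub>m L U)"

definition real_diag :: "nat \<Rightarrow> (nat \<Rightarrow> real) \<Rightarrow> complex mat" where
  "real_diag n d = mat_diag n (\<lambda>i. complex_of_real (d i))"

definition nepv_solution ::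
  "nat \<Rightarrow> nat \<Rightarrow> (complex mat \<Rightarrow> complex mat) \<Rightarrow> complex mat \<Rightarrow> (nat \<Rightarrow> real) \<Rightarrow> bool" where
  "nepv_solution n p A X1 lam \<longleftrightarrow>
     X1 \<in> carrier_mat n p \<and>
     A (X1 * mat_adjoint X1) * X1 = X1 * real_diag p lam \<and>
     mat_adjoint X1 * X1 = 1\<^sub>m p"

definition norm2_vec :: "complex vec \<Rightarrow> real" where
  "norm2_vec v = sqrt (\<Sum>i<dim_vec v. (cmod (v $ i))\<^sup>2)"

definition spectral_norm :: "complex mat \<Rightarrow> real" where
  "spectral_norm B = (SUP v \<in> {v \<in> carrier_vec (dim_col B). norm2_vec v \<le> 1}. norm2_vec (B *\<^sub>v v))"

definition frobenius_norm :: "complex mat \<Rightarrow> real" where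
  "frobenius_norm B = sqrt (\<Sum>i<dim_row B. \<Sum>j<dim_col B. (cmod (B $$ (i, j)))\<^sup>2)"

definition kronecker :: "complex mat \<Rightarrow> complex mat \<Rightarrow> complex mat" where
  "kronecker B C = mat (dim_row B * dim_row C) (dim_col B * dim_col C)
     (\<lambda>(i, j). B $$ (i div dim_row C, j div dim_col C) * C $$ (i mod dim_row C, j mod dim_col C))"

text \<open>\<open>outer x y\<close> is the matrix x y^H.\<close>

definition outer :: "complex vec \<Rightarrow> complex vec \<Rightarrow> complex mat" where
  "outer x y = mat (dim_vec x) (dim_vec y) (\<lambda>(i, j). x $ i * cnj (y $ j))"

text \<open>Column-stacking vectorization.\<close>

definition vectorize :: "'a mat \<Rightarrow> 'a vec" where
  "vectorize W =
     vec (dim_row W * dim_col W) (\<lambda>k. W $$ (k mod dim_row W, k div dim_row W))"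

definition half_dim :: "nat \<Rightarrow> nat" where
  "half_dim n = n * (n + 1) div 2"

definition vech :: "complex mat \<Rightarrow> complex vec" where
  "vech W = vec_of_list
     (concat (map (\<lambda>j. map (\<lambda>i. W $$ (i, j)) [j..<dim_row W]) [0..<dim_col W]))"

text \<open>
  For \<open>j \<le> i < n\<close>, \<open>vech_index n i j\<close> is the position of the entry \<open>(i, j)\<close> in \<open>vech W\<close>: the
  columns \<open>l < j\<close> of the lower triangular part have \<open>n - l\<close> entries each.
\<close>

definition vech_index :: "nat \<Rightarrow> nat \<Rightarrow> nat \<Rightarrow> nat" where
  "vech_index n i j = (\<Sum>l<j. n - l) + (i - j)"

definition vech_inv :: "nat \<Rightarrow> complex vec \<Rightarrow> complex mat" where
  "vech_inv n v = mat n n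
     (\<lambda>(i, j). if j \<le> i then v $ vech_index n i j else cnj (v $ vech_index n j i))"

definition T_mat :: "nat \<Rightarrow> complex mat" where
  "T_mat n = diag_block_mat
     (map (\<lambda>k. mat (n - k) n (\<lambda>(i, j). if j = k + i then 1 else 0)) [0..<n])"

definition symmetrize :: "nat \<Rightarrow> complex mat \<Rightarrow> complex mat" where
  "symmetrize n W = mat n n (\<lambda>(a, b).
     \<Sum>j<half_dim n. vech W $ j * vech_inv n (unit_vec (half_dim n) j) $$ (a, b))"

definition L_mat :: "nat \<Rightarrow> (complex mat \<Rightarrow> complex mat) \<Rightarrow> complex mat" where
  "L_mat n L = mat_of_cols (n\<^sup>2)
     (map (\<lambda>j. vectorize (L (vech_inv n (unit_vec (half_dim n) j)))) [0..<half_dim n])"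

definition recip_gap_mat :: "nat \<Rightarrow> nat \<Rightarrow> (nat \<Rightarrow> real) \<Rightarrow> real mat" where
  "recip_gap_mat n p lam = mat n n (\<lambda>(i, j).
     if i < p \<and> p \<le> j then 1 / (lam j - lam i)
     else if j < p \<and> p \<le> i then 1 / (lam i - lam j)
     else 0)"

definition D_mat :: "nat \<Rightarrow> nat \<Rightarrow> (nat \<Rightarrow> real) \<Rightarrow> complex mat" where
  "D_mat n p lam = real_diag (n\<^sup>2) (\<lambda>k. vectorize (recip_gap_mat n p lam) $ k)"

definition J_mat ::
  "nat \<Rightarrow> nat \<Rightarrow> (nat \<Rightarrow> real) \<Rightarrow> complex mat \<Rightarrow> (complex mat \<Rightarrow> complex mat) \<Rightarrow> complex mat" where
  "J_mat n p lam X L =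
     - (T_mat n * kronecker (map_mat cnj X) X * D_mat n p lam *
        kronecker (transpose_mat X) (mat_adjoint X) * L_mat n L)"

definition gap_pairs :: "nat \<Rightarrow> nat \<Rightarrow> (nat \<times> nat) set" where
  "gap_pairs n p = {..<p} \<times> {p..<n}"

text \<open>
  \<open>gap n p lam j\<close> is delta_j for \<open>1 \<le> j \<le> p * (n - p)\<close>, and infinite for larger \<open>j\<close>.
\<close>

definition gap :: "nat \<Rightarrow> nat \<Rightarrow> (nat \<Rightarrow> real) \<Rightarrow> nat \<Rightarrow> ereal" where
  "gap n p lam j =
     (if j \<le> p * (n - p)
      then ereal (sorted_list_of_multiset
             (image_mset (\<lambda>(i, k). \<bar>lam i - lam k\<bar>) (mset_set (gap_pairs n p))) ! (j - 1))
      else \<infinity>)"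

text \<open>
  \<open>smallest_gap_set n p lam q \<Omega>\<close>: \<open>\<Omega>\<close> is a possible choice of the set Omega_q. The enumeration
  \<open>\<sigma>\<close> of the pairs, which assigns to delta_j a pair attaining it, represents a way of breaking
  ties.
\<close>

definition smallest_gap_set ::
  "nat \<Rightarrow> nat \<Rightarrow> (nat \<Rightarrow> real) \<Rightarrow> nat \<Rightarrow> (nat \<times> nat) set \<Rightarrow> bool" where
  "smallest_gap_set n p lam q \<Omega> \<longleftrightarrow>
     (\<exists>\<sigma>. bij_betw \<sigma> {1..p * (n - p)} (gap_pairs n p) \<and>
          (\<forall>j \<in> {1..p * (n - p)}. case \<sigma> j of (i, k) \<Rightarrow> gap n p lam j = ereal \<bar>lam i - lam k\<bar>) \<and>
          \<Omega> = \<sigma> ` {1..q} \<union> prod.swap ` \<sigma> ` {1..q})"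

end

theory Submission
  imports Defs "HOL-Analysis.L2_Norm"
begin

text \<open>
  Put K = conj X (x) X (Kronecker product), so that J = - T K D K^H L'. If J v = \<mu> v with \<mu> \<noteq> 0, then w = L' v is nonzero and satisfies
  - (L' T K) D (K^H w) = \<mu> w: passing from a product to its cyclic permutation puts L' in front, so
  that L' T K maps vec E_lm to vec (L (S (x_l x_m^H))). Since X is unitary, K^H is an isometry, and
  the entries of D at the pairs in \<Omega> are split off and treated one by one by the triangle inequality;
  the remaining entries are at most 1 / delta_{q+1} in modulus, and T and K have norm at most 1.
\<close>

section \<open>Norms\<close>

lemma norm2_vec_L2_set: "norm2_vec v = L2_set (\<lambda>i. cmod (v $ i)) {..<dim_vec v}"
  by (simp add: norm2_vec_def L2_set_def)

lemma norm2_vec_nonneg [simp]: "0 \<le> norm2_vec v"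
  by (simp add: norm2_vec_L2_set)

lemma norm2_vec_pos:
  assumes "v \<in> carrier_vec n" "v \<noteq> 0\<^sub>v n"
  shows "0 < norm2_vec v"
proof -
  obtain i where i: "i < n" "v $ i \<noteq> 0"
    using assms by (auto simp: vec_eq_iff)
  then have "cmod (v $ i) \<le> norm2_vec v"
    unfolding norm2_vec_L2_set using assms by (intro member_le_L2_set) auto
  with i show ?thesis
    by (meson less_le_trans zero_less_norm_iff)
qed

lemma norm2_vec_smult: "norm2_vec (c \<cdot>\<^sub>v v) = cmod c * norm2_vec v"
  by (auto simp: norm2_vec_L2_set L2_set_right_distrib norm_mult intro!: L2_set_cong)

lemma norm2_vec_uminus: "norm2_vec (- v) = norm2_vec v"
  by (auto simp: norm2_vec_L2_set intro!: L2_set_cong)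

lemma norm2_vec_triangle:
  assumes "u \<in> carrier_vec n" "v \<in> carrier_vec n"
  shows "norm2_vec (u + v) \<le> norm2_vec u + norm2_vec v"
proof -
  have "norm2_vec (u + v) = L2_set (\<lambda>i. cmod (u $ i + v $ i)) {..<n}"
    using assms by (auto simp: norm2_vec_L2_set intro!: L2_set_cong)
  also have "\<dots> \<le> L2_set (\<lambda>i. cmod (u $ i) + cmod (v $ i)) {..<n}"
    by (intro L2_set_mono) (auto simp: norm_triangle_ineq)
  also have "\<dots> \<le> norm2_vec u + norm2_vec v"
    using assms L2_set_triangle_ineq by (simp add: norm2_vec_L2_set)
  finally show ?thesis .
qed

section \<open>The Frobenius and spectral norms as bounds for matrix-vector products\<close>

lemma frobenius_norm_L2_set:
  "frobenius_norm B = L2_set (\<lambda>ij. cmod (B $$ ij)) ({..<dim_row B} \<times> {..<dim_col B})"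
  by (simp add: frobenius_norm_def L2_set_def sum.cartesian_product)

lemma frobenius_norm_nonneg [simp]: "0 \<le> frobenius_norm B"
  by (simp add: frobenius_norm_L2_set)

lemma cmod_entry_le_frobenius_norm:
  "i < dim_row B \<Longrightarrow> j < dim_col B \<Longrightarrow> cmod (B $$ (i, j)) \<le> frobenius_norm B"
  unfolding frobenius_norm_L2_set by (intro member_le_L2_set) auto

text \<open>Cauchy-Schwarz bounds each component by the norm of the corresponding row, and the
  Euclidean norm of the row norms is the Frobenius norm. The estimate also makes the supremum in
  \<open>spectral_norm\<close> finite.\<close>

lemma norm2_vec_mult_mat_le_frobenius:
  assumes "B \<in> carrier_mat m n" "v \<in> carrier_vec n"
  shows "norm2_vec (B *\<^sub>v v) \<le> frobenius_norm B * norm2_vec v"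
proof -
  have row: "cmod ((B *\<^sub>v v) $ i) \<le> L2_set (\<lambda>j. cmod (B $$ (i, j))) {..<n} * norm2_vec v"
    if "i < m" for i
  proof -
    have "(B *\<^sub>v v) $ i = (\<Sum>j<n. B $$ (i, j) * v $ j)"
      using assms that by (simp add: scalar_prod_def lessThan_atLeast0)
    then have "cmod ((B *\<^sub>v v) $ i) \<le> (\<Sum>j<n. \<bar>cmod (B $$ (i, j))\<bar> * \<bar>cmod (v $ j)\<bar>)"
      by (auto simp flip: norm_mult intro!: norm_sum)
    also have "\<dots> \<le> L2_set (\<lambda>j. cmod (B $$ (i, j))) {..<n} * norm2_vec v"
      using L2_set_mult_ineq[of "\<lambda>j. cmod (B $$ (i, j))" "\<lambda>j. cmod (v $ j)" "{..<n}"] assms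
      by (simp add: norm2_vec_L2_set)
    finally show ?thesis .
  qed
  have "norm2_vec (B *\<^sub>v v)
      \<le> L2_set (\<lambda>i. L2_set (\<lambda>j. cmod (B $$ (i, j))) {..<n} * norm2_vec v) {..<m}"
    unfolding norm2_vec_L2_set[of "B *\<^sub>v v"] using assms row by (auto intro!: L2_set_mono)
  also have "\<dots> = L2_set (\<lambda>i. L2_set (\<lambda>j. cmod (B $$ (i, j))) {..<n}) {..<m} * norm2_vec v"
    by (simp add: L2_set_left_distrib)
  also have "L2_set (\<lambda>i. L2_set (\<lambda>j. cmod (B $$ (i, j))) {..<n}) {..<m} = frobenius_norm B"
    using assms by (simp add: frobenius_norm_def L2_set_def sum_nonneg)
  finally show ?thesis .
qed

text \<open>Rescaling \<open>v\<close> to norm 1 turns the claim into membership in the set whose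
  supremum is taken. A real supremum is an upper bound only if the set is bounded above, which the
  Frobenius bound provides.\<close>

lemma norm2_vec_mult_mat_le_spectral:
  assumes B: "B \<in> carrier_mat m n" and v: "v \<in> carrier_vec n"
  shows "norm2_vec (B *\<^sub>v v) \<le> spectral_norm B * norm2_vec v"
proof (cases "v = 0\<^sub>v n")
  case True
  then have "B *\<^sub>v v = 0\<^sub>v m" using B by (intro eq_vecI) auto
  with True show ?thesis by (simp add: norm2_vec_def)
next
  case False
  let ?S = "{v \<in> carrier_vec (dim_col B). norm2_vec v \<le> 1}"
  define r where "r = norm2_vec v"
  have r: "r > 0" using norm2_vec_pos[OF v False] by (simp add: r_def)
  define u where "u = complex_of_real (1 / r) \<cdot>\<^sub>v v"
  have "norm2_vec u = 1"
    using r by (simp add: u_def norm2_vec_smult r_def[symmetric] del: of_real_divide)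
  then have u: "u \<in> ?S" using B v by (simp add: u_def)
  have "norm2_vec (B *\<^sub>v w) \<le> frobenius_norm B" if "w \<in> ?S" for w
  proof -
    have "norm2_vec (B *\<^sub>v w) \<le> frobenius_norm B * norm2_vec w"
      using that B by (intro norm2_vec_mult_mat_le_frobenius) auto
    also have "\<dots> \<le> frobenius_norm B * 1"
      using that by (intro mult_left_mono) auto
    finally show ?thesis by simp
  qed
  then have "bdd_above ((\<lambda>w. norm2_vec (B *\<^sub>v w)) ` ?S)"
    by (rule bdd_aboveI2)
  then have "norm2_vec (B *\<^sub>v u) \<le> spectral_norm B"
    unfolding spectral_norm_def using u by (intro cSUP_upper)
  moreover have "norm2_vec (B *\<^sub>v u) = norm2_vec (B *\<^sub>v v) / r"
    using B v r by (simp add: u_def mult_mat_vec norm2_vec_smult norm_divide)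
  ultimately show ?thesis using r by (simp add: r_def[symmetric] divide_le_eq)
qed

text \<open>Any vector of positive norm forces this through the previous inequality. Without columns
  there is no such vector, but then the unit ball is the singleton of the empty vector and the
  supremum is the norm of its image.\<close>

lemma spectral_norm_nonneg: "0 \<le> spectral_norm B"
proof (cases "dim_col B = 0")
  case True
  then have "{v \<in> carrier_vec (dim_col B). norm2_vec v \<le> 1} = {0\<^sub>v 0}"
    by (auto simp: norm2_vec_def)
  then show ?thesis unfolding spectral_norm_def by simp
next
  case False
  define v :: "complex vec" where "v = unit_vec (dim_col B) 0"
  have "0 < norm2_vec v"
    by (rule norm2_vec_pos[of _ "dim_col B"]) (use False in \<open>auto simp: v_def vec_eq_iff\<close>)
  moreover have "0 \<le> spectral_norm B * norm2_vec v"
    using norm2_vec_mult_mat_le_spectral[of B "dim_row B" "dim_col B" v]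
    by (auto simp: v_def intro: order_trans[OF norm2_vec_nonneg])
  ultimately show ?thesis by (simp add: zero_le_mult_iff)
qed

section \<open>Adjoints and unitary invariance\<close>

lemma mat_adjoint_dim [simp]:
  "dim_row (mat_adjoint A) = dim_col A" "dim_col (mat_adjoint A) = dim_row A"
  by (auto simp: mat_adjoint_def)

lemma mat_adjoint_carrier [simp]: "A \<in> carrier_mat m n \<Longrightarrow> mat_adjoint A \<in> carrier_mat n m"
  by (intro carrier_matI) auto

lemma mat_adjoint_index [simp]:
  "i < dim_col A \<Longrightarrow> j < dim_row A \<Longrightarrow> mat_adjoint A $$ (i, j) = conjugate (A $$ (j, i))"
  by (simp add: mat_adjoint_def mat_of_rows_index)

lemma mat_adjoint_adjoint [simp]:
  fixes A :: "complex mat"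
  shows "mat_adjoint (mat_adjoint A) = A"
  by (intro eq_matI) auto

lemma mat_adjoint_mult:
  fixes A B :: "complex mat"
  assumes "A \<in> carrier_mat m n" "B \<in> carrier_mat n k"
  shows "mat_adjoint (A * B) = mat_adjoint B * mat_adjoint A"
  using assms by (intro eq_matI) (auto simp: scalar_prod_def mult.commute)

lemma frobenius_norm_adjoint [simp]: "frobenius_norm (mat_adjoint B) = frobenius_norm B"
  unfolding frobenius_norm_def by (subst sum.swap) simp

text \<open>Expresses the norm through the trace of B^H B, so that invariance under isometries
  becomes a matrix identity.\<close>

lemma frobenius_norm_sq_trace:
  "complex_of_real ((frobenius_norm B)\<^sup>2) = (\<Sum>j<dim_col B. (mat_adjoint B * B) $$ (j, j))"
proof -
  have "complex_of_real ((frobenius_norm B)\<^sup>2)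
      = (\<Sum>j<dim_col B. \<Sum>i<dim_row B. cnj (B $$ (i, j)) * B $$ (i, j))"
    unfolding frobenius_norm_def
    by (subst sum.swap)
      (simp add: sum_nonneg complex_norm_square mult.commute del: of_real_power)
  then show ?thesis by (simp add: scalar_prod_def lessThan_atLeast0)
qed

text \<open>In (U Z)^H (U Z) the inner factor U^H U cancels, so both sides have the same
  trace.\<close>

lemma frobenius_norm_isometry_mult:
  assumes U: "U \<in> carrier_mat m n" "mat_adjoint U * U = 1\<^sub>m n" and Z: "Z \<in> carrier_mat n k"
  shows "frobenius_norm (U * Z) = frobenius_norm Z"
proof -
  have "mat_adjoint (U * Z) * (U * Z) = mat_adjoint Z * (mat_adjoint U * U * Z)"
    using U(1) Z by (simp add: mat_adjoint_mult assoc_mult_mat[of _ k n _ m _ k]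
        assoc_mult_mat[of _ n m _ n _ k])
  also have "\<dots> = mat_adjoint Z * Z"
    using U Z by simp
  finally have "complex_of_real ((frobenius_norm (U * Z))\<^sup>2) = complex_of_real ((frobenius_norm Z)\<^sup>2)"
    using Z by (simp only: frobenius_norm_sq_trace) simp
  then have "(frobenius_norm (U * Z))\<^sup>2 = (frobenius_norm Z)\<^sup>2"
    using of_real_eq_iff by blast
  then show ?thesis by simp
qed

text \<open>Taking the adjoint moves the right factor to the left without changing the norm, so
  invariance under left multiplication is applied twice.\<close>

lemma frobenius_norm_unitary_conj:
  assumes U: "U \<in> carrier_mat n n" "mat_adjoint U * U = 1\<^sub>m n" and Z: "Z \<in> carrier_mat n n"
  shows "frobenius_norm (U * Z * mat_adjoint U) = frobenius_norm Z"
proof -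
  have "frobenius_norm (U * Z * mat_adjoint U) = frobenius_norm (mat_adjoint (U * Z * mat_adjoint U))"
    by simp
  also have "mat_adjoint (U * Z * mat_adjoint U) = U * (mat_adjoint (U * Z))"
    using U Z by (simp add: mat_adjoint_mult[of _ n n _ n])
  also have "frobenius_norm \<dots> = frobenius_norm Z"
    using U Z by (simp add: frobenius_norm_isometry_mult[of U n n _ n])
  finally show ?thesis .
qed

section \<open>Vectorization and the Kronecker product\<close>

lemma mod_div_less:
  fixes k :: nat
  assumes "k < m * n"
  shows "k mod m < m" "k div m < n"
  using assms by (cases "m = 0"; simp add: less_mult_imp_div_less mult.commute)+

text \<open>Column-major numbering: \<open>k\<close> corresponds to row \<open>k mod a\<close> and
  column \<open>k div a\<close>, with inverse \<open>j * a + i\<close>.\<close>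

lemma sum_mod_div:
  fixes f :: "nat \<Rightarrow> nat \<Rightarrow> 'a::comm_monoid_add"
  shows "(\<Sum>k<a * b. f (k mod a) (k div a)) = (\<Sum>i<a. \<Sum>j<b. f i j)"
proof -
  have less: "j * a + i < a * b" if "i < a" "j < b" for i j
  proof -
    have "j * a + i < Suc j * a" using that by simp
    also have "\<dots> \<le> b * a" using that by (intro mult_right_mono) auto
    finally show ?thesis by (simp add: mult.commute)
  qed
  have "(\<Sum>k<a * b. f (k mod a) (k div a)) = (\<Sum>(i, j)\<in>{..<a} \<times> {..<b}. f i j)"
    by (rule sum.reindex_bij_witness[where i = "\<lambda>(i, j). j * a + i" and j = "\<lambda>k. (k mod a, k div a)"])
      (auto simp: less mod_div_less)
  then show ?thesis by (simp add: sum.cartesian_product)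
qed

lemma vectorize_carrier: "W \<in> carrier_mat m n \<Longrightarrow> vectorize W \<in> carrier_vec (m * n)"
  by (auto simp: vectorize_def)

lemma norm2_vec_vectorize: "norm2_vec (vectorize W) = frobenius_norm W"
  unfolding norm2_vec_def frobenius_norm_def vectorize_def
  by (simp flip: sum_mod_div)

lemma vectorize_add:
  assumes "U \<in> carrier_mat m n" "V \<in> carrier_mat m n"
  shows "vectorize (U + V) = vectorize U + vectorize V"
  using assms by (intro eq_vecI) (auto simp: vectorize_def mod_div_less)

lemma vectorize_smult: "vectorize (c \<cdot>\<^sub>m U) = c \<cdot>\<^sub>v vectorize U"
  by (intro eq_vecI) (auto simp: vectorize_def mod_div_less)

text \<open>Lets an arbitrary vector, such as the image of an eigenvector under L', be treated as a
  matrix.\<close>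

lemma vectorize_surj:
  assumes "w \<in> carrier_vec (m * n)"
  obtains W where "W \<in> carrier_mat m n" "w = vectorize W"
proof
  show "w = vectorize (mat m n (\<lambda>(i, j). w $ (j * m + i)))"
    using assms by (intro eq_vecI) (auto simp: vectorize_def mod_div_less)
qed simp

lemma kronecker_carrier:
  "B \<in> carrier_mat m n \<Longrightarrow> C \<in> carrier_mat k l \<Longrightarrow> kronecker B C \<in> carrier_mat (m * k) (n * l)"
  by (auto simp: kronecker_def)

text \<open>Turns the Kronecker factors of \<open>J_mat\<close> into the conjugations W -> X W X^H
  and W -> X^H W X, so that no Kronecker product has to be estimated directly.\<close>

lemma kronecker_mult_vectorize:
  assumes B: "B \<in> carrier_mat m n" and C: "C \<in> carrier_mat k l" and W: "W \<in> carrier_mat l n"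
  shows "kronecker B C *\<^sub>v vectorize W = vectorize (C * W * transpose_mat B)"
proof (intro eq_vecI)
  fix r assume "r < dim_vec (vectorize (C * W * transpose_mat B))"
  then have r: "r < k * m" using B C by (simp add: vectorize_def)
  note r' = mod_div_less[OF r]
  have "(kronecker B C *\<^sub>v vectorize W) $ r
      = (\<Sum>s<l * n. B $$ (r div k, s div l) * C $$ (r mod k, s mod l) * W $$ (s mod l, s div l))"
    using B C W r r' by (simp add: kronecker_def vectorize_def scalar_prod_def lessThan_atLeast0
        mult.commute[of _ k] mult.commute[of _ l])
  also have "\<dots> = (\<Sum>i<l. \<Sum>j<n. B $$ (r div k, j) * C $$ (r mod k, i) * W $$ (i, j))"
    by (rule sum_mod_div)
  also have "\<dots> = (\<Sum>i<l. C $$ (r mod k, i) * (\<Sum>j<n. W $$ (i, j) * B $$ (r div k, j)))"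
    by (simp add: sum_distrib_left ac_simps)
  also have "\<dots> = vectorize (C * W * transpose_mat B) $ r"
    using B C W r r' by (simp add: vectorize_def scalar_prod_def lessThan_atLeast0)
  finally show "(kronecker B C *\<^sub>v vectorize W) $ r = vectorize (C * W * transpose_mat B) $ r" .
qed (use B C in \<open>auto simp: kronecker_def vectorize_def\<close>)

text \<open>Applied to unit vectors, with \<open>A\<close> and \<open>B\<close> both equal to X, it
  gives X E_lm X^H = x_l x_m^H.\<close>

lemma outer_sandwich:
  assumes A: "A \<in> carrier_mat m n" and B: "B \<in> carrier_mat k l"
    and x: "x \<in> carrier_vec n" and y: "y \<in> carrier_vec l"
  shows "A * outer x y * mat_adjoint B = outer (A *\<^sub>v x) (B *\<^sub>v y)"
proof (intro eq_matI)
  fix i j assume "i < dim_row (outer (A *\<^sub>v x) (B *\<^sub>v y))" "j < dim_col (outer (A *\<^sub>v x) (B *\<^sub>v y))"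
  then have ij: "i < m" "j < k" using A B by (auto simp: outer_def)
  have "(A * outer x y * mat_adjoint B) $$ (i, j)
     = (\<Sum>b<l. (\<Sum>a<n. A $$ (i, a) * (x $ a * cnj (y $ b))) * cnj (B $$ (j, b)))"
    using A B x y ij by (simp add: outer_def scalar_prod_def lessThan_atLeast0)
  also have "\<dots> = (\<Sum>b<l. (\<Sum>a<n. A $$ (i, a) * x $ a) * cnj (B $$ (j, b) * y $ b))"
    by (simp add: sum_distrib_left sum_distrib_right ac_simps)
  also have "\<dots> = (\<Sum>a<n. A $$ (i, a) * x $ a) * cnj (\<Sum>b<l. B $$ (j, b) * y $ b)"
    by (simp add: sum_distrib_left)
  also have "\<dots> = outer (A *\<^sub>v x) (B *\<^sub>v y) $$ (i, j)"
    using A B x y ij by (simp add: outer_def scalar_prod_def lessThan_atLeast0)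
  finally show "(A * outer x y * mat_adjoint B) $$ (i, j) = outer (A *\<^sub>v x) (B *\<^sub>v y) $$ (i, j)" .
qed (use A B in \<open>auto simp: outer_def\<close>)

section \<open>Half-vectorization\<close>

lemma mult_append_diag_block:
  assumes "dim_vec v = dim_col B" "dim_vec w = dim_col (diag_block_mat Bs)"
  shows "diag_block_mat (B # Bs) *\<^sub>v (v @\<^sub>v w) = (B *\<^sub>v v) @\<^sub>v (diag_block_mat Bs *\<^sub>v w)"
proof -
  let ?D = "diag_block_mat Bs"
  have "four_block_mat B (0\<^sub>m (dim_row B) (dim_col ?D)) (0\<^sub>m (dim_row ?D) (dim_col B)) ?D *\<^sub>v (v @\<^sub>v w)
      = (B *\<^sub>v v + 0\<^sub>m (dim_row B) (dim_col ?D) *\<^sub>v w)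
        @\<^sub>v (0\<^sub>m (dim_row ?D) (dim_col B) *\<^sub>v v + ?D *\<^sub>v w)"
    by (rule four_block_mat_mult_vec[of _ "dim_row B" "dim_col B" _ "dim_col ?D" _ "dim_row ?D"])
      (use assms in \<open>auto intro: carrier_vecI\<close>)
  also have "\<dots> = (B *\<^sub>v v) @\<^sub>v (?D *\<^sub>v w)"
    using assms by (intro arg_cong2[of _ _ _ _ "(@\<^sub>v)"] eq_vecI) (auto simp: scalar_prod_def)
  finally show ?thesis by (simp add: Let_def)
qed

lemma vec_of_list_append: "vec_of_list (xs @ ys) = vec_of_list xs @\<^sub>v vec_of_list ys"
  by (intro eq_vecI) (auto simp: vec_of_list_index nth_append)

text \<open>Each block acts on its own segment. Blocks may be rectangular and of different sizes, as
  those of \<open>T_mat\<close> are.\<close>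

lemma diag_block_mat_mult_concat:
  assumes "\<And>k. k \<in> set ks \<Longrightarrow> dim_col (B k) = length (c k)"
    and "\<And>k. k \<in> set ks \<Longrightarrow> B k *\<^sub>v vec_of_list (c k) = vec_of_list (d k)"
  shows "diag_block_mat (map B ks) *\<^sub>v vec_of_list (concat (map c ks))
       = vec_of_list (concat (map d ks))"
  using assms
proof (induction ks)
  case Nil
  show ?case by (intro eq_vecI) auto
next
  case (Cons k ks)
  have "dim_col (diag_block_mat (map B ks)) = length (concat (map c ks))"
    using Cons.prems by (auto simp: dim_diag_block_mat length_concat o_def intro!: arg_cong[of _ _ sum_list])
  then show ?case
    using Cons by (simp add: vec_of_list_append mult_append_diag_block del: diag_block_mat.simps)
qed

lemma nth_concat_columns:
  assumes "k < m * n"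
  shows "length (concat (map (\<lambda>j. map (f j) [0..<m]) [0..<n])) = m * n"
    and "concat (map (\<lambda>j. map (f j) [0..<m]) [0..<n]) ! k = f (k div m) (k mod m)"
proof -
  \<comment> \<open>Kept general in \<open>n\<close>, because the induction below uses it for the
    list without its last column.\<close>
  show len: "length (concat (map (\<lambda>j. map (f j) [0..<m]) [0..<n])) = m * n" for n
    by (induction n) auto
  show "concat (map (\<lambda>j. map (f j) [0..<m]) [0..<n]) ! k = f (k div m) (k mod m)"
    using assms
  proof (induction n)
    case (Suc n)
    show ?case
    proof (cases "k < m * n")
      case False
      \<comment> \<open>Position \<open>k\<close> lies in the last column; with offset
        \<open>r < m\<close> the quotient is \<open>n\<close> and the remainder
        \<open>r\<close>.\<close>
      then have "k = m * n + (k - m * n)" "k - m * n < m" using Suc.prems by auto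
      then obtain r where "k = m * n + r" "r < m" by blast
      then show ?thesis by (simp add: nth_append len)
    qed (use Suc.IH in \<open>simp add: nth_append len\<close>)
  qed simp
qed

text \<open>Brings \<open>vectorize\<close> into the form in which \<open>vech\<close> is defined,
  so that the two can be compared column by column.\<close>

lemma vectorize_concat:
  "vectorize W = vec_of_list (concat (map (\<lambda>j. map (\<lambda>i. W $$ (i, j)) [0..<dim_row W]) [0..<dim_col W]))"
  by (intro eq_vecI) (auto simp: vectorize_def vec_of_list_index nth_concat_columns length_concat
      o_def sum_list_triv mult.commute[of "dim_col W"])

text \<open>Row \<open>i\<close> of block \<open>k\<close> selects entry \<open>k + i\<close>, so
  the block drops the first \<open>k\<close> entries of column \<open>k\<close>, which are those
  above the diagonal.\<close>

lemma T_mat_mult_vectorize: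
  assumes "W \<in> carrier_mat n n"
  shows "T_mat n *\<^sub>v vectorize W = vech W"
proof -
  let ?B = "\<lambda>k. mat (n - k) n (\<lambda>(i, j). if j = k + i then 1 else 0) :: complex mat"
  have "?B k *\<^sub>v vec_of_list (map (\<lambda>i. W $$ (i, k)) [0..<n]) = vec_of_list (map (\<lambda>i. W $$ (i, k)) [k..<n])"
    for k
    by (intro eq_vecI) (auto simp: scalar_prod_def vec_of_list_index if_distrib[of "\<lambda>x. x * _"] sum.delta cong: if_cong)
  then show ?thesis
    using assms unfolding T_mat_def vech_def vectorize_concat
    by (simp add: diag_block_mat_mult_concat)
qed

text \<open>Reversing the order of summation turns n + ... + 1 into the triangular sum 1 + ... +
  n.\<close>

lemma sum_list_column_lengths: "sum_list (map (\<lambda>k. n - k) [0..<n]) = half_dim n"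
proof -
  have "sum_list (map (\<lambda>k. n - k) [0..<n]) = (\<Sum>k<n. n - k)"
    by (simp add: sum_list_distinct_conv_sum_set lessThan_atLeast0)
  also have "\<dots> = (\<Sum>k<n. Suc k)"
    by (subst sum.nat_diff_reindex[symmetric]) (auto intro!: sum.cong)
  also have "\<dots> = half_dim n"
    unfolding half_dim_def by (induction n) auto
  finally show ?thesis .
qed

lemma vech_carrier:
  assumes "W \<in> carrier_mat n n"
  shows "vech W \<in> carrier_vec (half_dim n)"
  using assms by (auto simp: vech_def length_concat o_def sum_list_column_lengths intro!: carrier_vecI)

lemma T_mat_carrier: "T_mat n \<in> carrier_mat (half_dim n) (n * n)"
  by (auto simp: T_mat_def dim_diag_block_mat o_def sum_list_column_lengths sum_list_triv intro!: carrier_matI)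

lemma norm2_vec_of_list: "norm2_vec (vec_of_list xs) = sqrt (\<Sum>x\<leftarrow>xs. (cmod x)\<^sup>2)"
  by (simp add: norm2_vec_def vec_of_list_index sum_list_sum_nth lessThan_atLeast0)

lemma sum_list_concat_mono:
  fixes f g :: "'a \<Rightarrow> real list"
  assumes "\<And>x. x \<in> set xs \<Longrightarrow> sum_list (f x) \<le> sum_list (g x)"
  shows "sum_list (concat (map f xs)) \<le> sum_list (concat (map g xs))"
  using assms by (induction xs) (auto intro!: add_mono)

text \<open>Each column segment in \<open>vech W\<close> is a tail of the full column. Together with
  \<open>T_mat_mult_vectorize\<close> this says that T has norm at most 1.\<close>

lemma norm2_vec_vech_le: "norm2_vec (vech W) \<le> frobenius_norm W"
proof -
  have "(\<Sum>i\<leftarrow>[j..<dim_row W]. (cmod (W $$ (i, j)))\<^sup>2) \<le> (\<Sum>i\<leftarrow>[0..<dim_row W]. (cmod (W $$ (i, j)))\<^sup>2)"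
    for j
    by (simp add: sum_list_distinct_conv_sum_set) (auto intro!: sum_mono2)
  then have "norm2_vec (vech W) \<le> norm2_vec (vectorize W)"
    unfolding vech_def vectorize_concat norm2_vec_of_list
    by (auto simp: map_concat o_def intro!: sum_list_concat_mono)
  then show ?thesis by (simp add: norm2_vec_vectorize)
qed

section \<open>Linearity of \<open>L\<close> and the action of the matrix L'\<close>

lemma L_mat_carrier: "L_mat n L \<in> carrier_mat (n * n) (half_dim n)"
  by (auto simp: L_mat_def power2_eq_square intro!: carrier_matI)

lemma linear_on_mats_carrier:
  "linear_on_mats n L \<Longrightarrow> U \<in> carrier_mat n n \<Longrightarrow> L U \<in> carrier_mat n n"
  by (auto simp: linear_on_mats_def)

lemma linear_on_mats_sum:
  fixes m :: nat
  assumes L: "linear_on_mats n L" and B: "\<And>j. B j \<in> carrier_mat n n"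
  shows "L (mat n n (\<lambda>(a, b). \<Sum>j<m. c j * B j $$ (a, b)))
       = mat n n (\<lambda>(a, b). \<Sum>j<m. c j * L (B j) $$ (a, b))"
proof (induction m)
  case 0
  have LB: "L (B 0) \<in> carrier_mat n n" by (intro linear_on_mats_carrier[OF L] B)
  \<comment> \<open>The zero matrix is written as a multiple of \<open>B 0\<close>, so that
    homogeneity shows that \<open>L\<close> maps it to zero.\<close>
  have "mat n n (\<lambda>(a, b). \<Sum>j<0. c j * B j $$ (a, b)) = 0 \<cdot>\<^sub>m B 0"
    using B[of 0] by (intro eq_matI) auto
  then have "L (mat n n (\<lambda>(a, b). \<Sum>j<0. c j * B j $$ (a, b))) = 0 \<cdot>\<^sub>m L (B 0)"
    using L B[of 0] by (simp add: linear_on_mats_def)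
  also have "\<dots> = mat n n (\<lambda>(a, b). \<Sum>j<0. c j * L (B j) $$ (a, b))"
    using LB by (intro eq_matI) auto
  finally show ?case .
next
  case (Suc m)
  let ?P = "mat n n (\<lambda>(a, b). \<Sum>j<m. c j * B j $$ (a, b))"
  have LB: "L (B m) \<in> carrier_mat n n" by (intro linear_on_mats_carrier[OF L] B)
  have "mat n n (\<lambda>(a, b). \<Sum>j<Suc m. c j * B j $$ (a, b)) = ?P + c m \<cdot>\<^sub>m B m"
    using B[of m] by (intro eq_matI) auto
  also have "L \<dots> = L ?P + c m \<cdot>\<^sub>m L (B m)"
    using L B[of m] by (simp add: linear_on_mats_def)
  also have "\<dots> = mat n n (\<lambda>(a, b). \<Sum>j<Suc m. c j * L (B j) $$ (a, b))"
    unfolding Suc.IH using LB by (intro eq_matI) auto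
  finally show ?case .
qed

text \<open>The product combines the columns vec (L (vech^-1 (e_j))) with coefficients
  \<open>vech W $ j\<close>. By linearity \<open>L\<close> can be pulled out, and the combination
  left inside is the definition of S(W).\<close>

lemma L_mat_mult_vech:
  assumes L: "linear_on_mats n L" and W: "W \<in> carrier_mat n n"
  shows "L_mat n L *\<^sub>v vech W = vectorize (L (symmetrize n W))"
proof (intro eq_vecI)
  let ?B = "\<lambda>j. vech_inv n (unit_vec (half_dim n) j)"
  have B: "?B j \<in> carrier_mat n n" for j by (simp add: vech_inv_def)
  have LB: "L (?B j) \<in> carrier_mat n n" for j by (intro linear_on_mats_carrier[OF L] B)
  have LS: "L (symmetrize n W) = mat n n (\<lambda>(a, b). \<Sum>j<half_dim n. vech W $ j * L (?B j) $$ (a, b))"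
    unfolding symmetrize_def by (rule linear_on_mats_sum[OF L B])
  then show "dim_vec (L_mat n L *\<^sub>v vech W) = dim_vec (vectorize (L (symmetrize n W)))"
    using L_mat_carrier[of n L] by (simp add: vectorize_def)
  fix r assume "r < dim_vec (vectorize (L (symmetrize n W)))"
  then have r: "r < n * n" by (simp add: LS vectorize_def)
  note r' = mod_div_less[OF r]
  have "(L_mat n L *\<^sub>v vech W) $ r = (\<Sum>j<half_dim n. vectorize (L (?B j)) $ r * vech W $ j)"
    using vech_carrier[OF W] r by (simp add: L_mat_def scalar_prod_def lessThan_atLeast0
        power2_eq_square mat_of_cols_index)
  also have "\<dots> = vectorize (L (symmetrize n W)) $ r"
    using r r' carrier_matD[OF LB] by (simp add: LS vectorize_def mult.commute)
  finally show "(L_mat n L *\<^sub>v vech W) $ r = vectorize (L (symmetrize n W)) $ r" .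
qed

section \<open>Splitting off selected entries\<close>

text \<open>Y is the matrix with the positions in \<open>F\<close> set to zero plus the sum of Y_ij
  E_ij over \<open>F\<close>; linearity and the triangle inequality do the rest.\<close>

lemma norm2_vec_mult_split:
  assumes M: "M \<in> carrier_mat m (n * n)" and Y: "Y \<in> carrier_mat n n"
    and F: "F \<subseteq> {..<n} \<times> {..<n}"
  shows "norm2_vec (M *\<^sub>v vectorize Y)
    \<le> norm2_vec (M *\<^sub>v vectorize (mat n n (\<lambda>ij. if ij \<in> F then 0 else Y $$ ij)))
      + (\<Sum>(i, j)\<in>F. cmod (Y $$ (i, j)) *
           norm2_vec (M *\<^sub>v vectorize (outer (unit_vec n i) (unit_vec n j))))"
proof -
  let ?Z = "\<lambda>F. mat n n (\<lambda>ij. if ij \<in> F then 0 else Y $$ ij)"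
  let ?E = "\<lambda>i j. outer (unit_vec n i) (unit_vec n j)"
  have "finite F" using F by (rule finite_subset) simp
  then show ?thesis using F
  proof (induction F rule: finite_induct)
    case empty
    have "?Z {} = Y" using Y by (intro eq_matI) auto
    then show ?case by simp
  next
    case (insert ij F)
    obtain i j where ij: "ij = (i, j)" "i < n" "j < n" using insert.prems by auto
    have E: "?E i j \<in> carrier_mat n n" by (simp add: outer_def)
    \<comment> \<open>As \<open>ij\<close> is not in \<open>F\<close>, the left matrix still has the
      entry of Y there, and this entry is the only difference.\<close>
    have "?Z F = ?Z (insert ij F) + Y $$ (i, j) \<cdot>\<^sub>m ?E i j"
      using insert.hyps ij by (intro eq_matI) (auto simp: outer_def)
    then have "vectorize (?Z F) = vectorize (?Z (insert ij F)) + Y $$ (i, j) \<cdot>\<^sub>v vectorize (?E i j)"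
      using E by (simp add: vectorize_add[of _ n n] vectorize_smult)
    moreover have "vectorize (?Z (insert ij F)) \<in> carrier_vec (n * n)"
      by (rule vectorize_carrier) simp
    moreover note vectorize_carrier[OF E]
    ultimately have "M *\<^sub>v vectorize (?Z F) = M *\<^sub>v vectorize (?Z (insert ij F))
        + Y $$ (i, j) \<cdot>\<^sub>v (M *\<^sub>v vectorize (?E i j))"
      by (simp only: mult_add_distrib_mat_vec[OF M] mult_mat_vec[OF M] smult_carrier_vec)
    moreover have "M *\<^sub>v u \<in> carrier_vec m" for u
      using M by (intro carrier_vecI) simp
    ultimately have split: "norm2_vec (M *\<^sub>v vectorize (?Z F))
        \<le> norm2_vec (M *\<^sub>v vectorize (?Z (insert ij F)))
          + norm2_vec (Y $$ (i, j) \<cdot>\<^sub>v (M *\<^sub>v vectorize (?E i j)))"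
      by (simp only: norm2_vec_triangle[of _ m] smult_carrier_vec)
    show ?case
      using insert.IH insert.prems insert.hyps split by (simp add: ij norm2_vec_smult)
  qed
qed

section \<open>Gaps\<close>

lemma finite_gap_pairs [simp]: "finite (gap_pairs n p)"
  by (simp add: gap_pairs_def)

lemma card_gap_pairs: "card (gap_pairs n p) = p * (n - p)"
  by (simp add: gap_pairs_def)

text \<open>The gaps are entries of a sorted list, counted from 1 where list positions start at 0;
  the bound on \<open>j\<close> keeps both indices in the finite branch of
  \<open>gap\<close>.\<close>

lemma gap_mono:
  assumes "1 \<le> i" "i \<le> j" "j \<le> p * (n - p)"
  shows "gap n p lam i \<le> gap n p lam j"
proof -
  let ?xs = "sorted_list_of_multiset
    (image_mset (\<lambda>(i, k). \<bar>lam i - lam k\<bar>) (mset_set (gap_pairs n p)))"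
  have "length ?xs = p * (n - p)"
    by (simp add: card_gap_pairs flip: size_mset)
  then have "?xs ! (i - 1) \<le> ?xs ! (j - 1)"
    using assms by (intro sorted_nth_mono) auto
  then show ?thesis using assms by (simp add: gap_def)
qed

text \<open>The enumeration reaches every pair, and a pair outside \<Omega> can only be reached at
  an index beyond \<open>q\<close>.\<close>

lemma gap_le_outside:
  assumes \<Omega>: "smallest_gap_set n p lam q \<Omega>" and "(i, k) \<in> gap_pairs n p" "(i, k) \<notin> \<Omega>"
  shows "gap n p lam (q + 1) \<le> ereal \<bar>lam i - lam k\<bar>"
proof -
  obtain \<sigma> where \<sigma>: "bij_betw \<sigma> {1..p * (n - p)} (gap_pairs n p)"
    "\<forall>j \<in> {1..p * (n - p)}. case \<sigma> j of (i, k) \<Rightarrow> gap n p lam j = ereal \<bar>lam i - lam k\<bar>"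
    "\<Omega> = \<sigma> ` {1..q} \<union> prod.swap ` \<sigma> ` {1..q}"
    using \<Omega> unfolding smallest_gap_set_def by blast
  then obtain j where j: "j \<in> {1..p * (n - p)}" "\<sigma> j = (i, k)"
    using assms(2) unfolding bij_betw_def by (metis imageE)
  then have "q + 1 \<le> j"
  proof -
    have "\<sigma> j \<notin> \<sigma> ` {1..q}" using assms(3) \<sigma>(3) j(2) by simp
    then have "j \<notin> {1..q}" by blast
    with j(1) show ?thesis by simp
  qed
  then have "gap n p lam (q + 1) \<le> gap n p lam j"
    using j by (intro gap_mono) auto
  with bspec[OF \<sigma>(2) j(1)] j(2) show ?thesis by simp
qed

lemma smallest_gap_set_swap:
  assumes "smallest_gap_set n p lam q \<Omega>"
  shows "(k, i) \<in> \<Omega> \<longleftrightarrow> (i, k) \<in> \<Omega>"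
proof -
  obtain B where "\<Omega> = B \<union> prod.swap ` B"
    using assms unfolding smallest_gap_set_def by blast
  then show ?thesis by (auto simp only: Un_iff pair_in_swap_image)
qed

lemma smallest_gap_set_subset:
  assumes "smallest_gap_set n p lam q \<Omega>" "q \<le> p * (n - p)" "p \<le> n"
  shows "\<Omega> \<subseteq> {..<n} \<times> {..<n}"
proof -
  obtain \<sigma> where \<sigma>: "\<sigma> ` {1..p * (n - p)} = gap_pairs n p"
    "\<Omega> = \<sigma> ` {1..q} \<union> prod.swap ` \<sigma> ` {1..q}"
    using assms(1) unfolding smallest_gap_set_def bij_betw_def by blast
  have "\<sigma> ` {1..q} \<subseteq> {..<n} \<times> {..<n}"
  proof -
    have "\<sigma> ` {1..q} \<subseteq> \<sigma> ` {1..p * (n - p)}"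
      using assms(2) by (intro image_mono) auto
    also have "\<dots> \<subseteq> {..<n} \<times> {..<n}"
      using assms(3) unfolding \<sigma>(1) by (auto simp: gap_pairs_def)
    finally show ?thesis .
  qed
  then show ?thesis unfolding \<sigma>(2) by auto
qed

lemma gap_pos:
  assumes "\<And>i k. (i, k) \<in> gap_pairs n p \<Longrightarrow> lam i \<noteq> lam k" "1 \<le> j"
  shows "0 < gap n p lam j"
proof (cases "j \<le> p * (n - p)")
  case True
  let ?xs = "sorted_list_of_multiset
    (image_mset (\<lambda>(i, k). \<bar>lam i - lam k\<bar>) (mset_set (gap_pairs n p)))"
  have "length ?xs = p * (n - p)"
    by (simp add: card_gap_pairs flip: size_mset)
  then have "?xs ! (j - 1) \<in> set ?xs"
    using True assms(2) by (intro nth_mem) auto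
  then have "0 < ?xs ! (j - 1)"
    using assms(1) by auto
  with True show ?thesis by (simp add: gap_def)
qed (simp add: gap_def)

text \<open>Replaces division by an extended real with multiplication by a real \<open>r\<close>,
  namely 1 / delta_{q+1}, or 0 if that gap is infinite.\<close>

lemma recip_gap_bound_outside:
  assumes \<Omega>: "smallest_gap_set n p lam q \<Omega>"
    and ne: "\<And>i k. (i, k) \<in> gap_pairs n p \<Longrightarrow> lam i \<noteq> lam k"
  obtains r where "0 \<le> r" "\<And>s. ereal s / gap n p lam (q + 1) = ereal (s * r)"
    "\<And>i j. i < n \<Longrightarrow> j < n \<Longrightarrow> (i, j) \<notin> \<Omega> \<Longrightarrow> \<bar>recip_gap_mat n p lam $$ (i, j)\<bar> \<le> r"
proof -
  have pos: "0 < gap n p lam (q + 1)" by (rule gap_pos[OF ne]) auto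
  define r where "r = (if gap n p lam (q + 1) = \<infinity> then 0 else 1 / real_of_ereal (gap n p lam (q + 1)))"
  have r0: "0 \<le> r"
    using pos by (cases "gap n p lam (q + 1)") (simp_all add: r_def)
  have r: "ereal s / gap n p lam (q + 1) = ereal (s * r)" for s
    using pos by (cases "gap n p lam (q + 1)") (simp_all add: r_def)
  have inv: "1 / \<bar>lam i - lam k\<bar> \<le> r" if "(i, k) \<in> gap_pairs n p" "(i, k) \<notin> \<Omega>" for i k
  proof -
    have "gap n p lam (q + 1) \<le> ereal \<bar>lam i - lam k\<bar>"
      by (rule gap_le_outside[OF \<Omega> that])
    with pos show ?thesis
      \<comment> \<open>An infinite gap cannot lie below a real distance, so in that case no pair is
        left outside \<Omega>.\<close>
      by (cases "gap n p lam (q + 1)") (auto simp: r_def intro!: divide_left_mono mult_pos_pos)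
  qed
  have "\<bar>recip_gap_mat n p lam $$ (i, j)\<bar> \<le> r" if ij: "i < n" "j < n" "(i, j) \<notin> \<Omega>" for i j
  proof -
    \<comment> \<open>The lower left block reduces to the upper right one because \<Omega> is
      symmetric; elsewhere the entry is zero.\<close>
    consider "i < p" "p \<le> j" | "j < p" "p \<le> i" | "recip_gap_mat n p lam $$ (i, j) = 0"
      using ij by (cases "i < p"; cases "j < p") (auto simp: recip_gap_mat_def)
    then show ?thesis
    proof cases
      case 1
      then show ?thesis using inv[of i j] ij
        by (simp add: recip_gap_mat_def gap_pairs_def abs_minus_commute)
    next
      case 2
      then show ?thesis using inv[of j i] ij smallest_gap_set_swap[OF \<Omega>, of i j]
        by (simp add: recip_gap_mat_def gap_pairs_def abs_minus_commute)
    qed (use r0 in simp)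
  qed
  with r0 r show ?thesis by (rule that)
qed

text \<open>Equality holds in the two off-diagonal blocks. Elsewhere the entry is 0 and the right
  side is nonnegative, also for equal eigenvalues, since \<open>1 / 0 = 0\<close>.\<close>

lemma abs_recip_gap_le:
  assumes "i < n" "j < n"
  shows "\<bar>recip_gap_mat n p lam $$ (i, j)\<bar> \<le> 1 / \<bar>lam i - lam j\<bar>"
  using assms by (auto simp: recip_gap_mat_def abs_minus_commute)

section \<open>The eigenvalue bound\<close>

lemma D_mat_carrier: "D_mat n p lam \<in> carrier_mat (n * n) (n * n)"
  by (simp add: D_mat_def real_diag_def power2_eq_square)

lemma mat_diag_mult_vec:
  fixes v :: "'a::semiring_1 vec"
  assumes "v \<in> carrier_vec n"
  shows "mat_diag n f *\<^sub>v v = vec n (\<lambda>i. f i * v $ i)"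
  using assms
  by (intro eq_vecI) (auto simp: mat_diag_def scalar_prod_def if_distrib[of "\<lambda>x. x * _"]
      sum.delta sum.delta' cong: if_cong)

lemma mult_mat_vec_uminus:
  fixes v :: "'a::comm_ring_1 vec"
  assumes "B \<in> carrier_mat m n" "v \<in> carrier_vec n"
  shows "B *\<^sub>v (- v) = - (B *\<^sub>v v)"
  using assms by (intro eq_vecI) auto

lemma D_mat_mult_vectorize:
  assumes W: "W \<in> carrier_mat n n"
  shows "D_mat n p lam *\<^sub>v vectorize W
    = vectorize (mat n n (\<lambda>ij. complex_of_real (recip_gap_mat n p lam $$ ij) * W $$ ij))"
proof -
  have "vectorize W \<in> carrier_vec (n\<^sup>2)"
    using W by (simp add: vectorize_carrier power2_eq_square)
  then show ?thesis
    using W unfolding D_mat_def real_diag_def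
    by (intro eq_vecI)
      (auto simp: mat_diag_mult_vec vectorize_def recip_gap_mat_def power2_eq_square mod_div_less)
qed

lemma frobenius_norm_scaled_mono:
  assumes "dim_row B = dim_row C" "dim_col B = dim_col C" "0 \<le> r"
    and "\<And>i j. i < dim_row C \<Longrightarrow> j < dim_col C \<Longrightarrow> cmod (B $$ (i, j)) \<le> r * cmod (C $$ (i, j))"
  shows "frobenius_norm B \<le> r * frobenius_norm C"
  unfolding frobenius_norm_L2_set using assms
  by (auto simp: L2_set_right_distrib intro!: L2_set_mono)

text \<open>The order of the gaps enters only through a set \<open>F\<close> of positions and a
  bound \<open>r\<close> on the reciprocal gaps outside it.\<close>

lemma J_mat_eigenvalue_bound:
  assumes L: "linear_on_mats n L" and X: "unitary_mat n X"
    and F: "F \<subseteq> {..<n} \<times> {..<n}" and r: "0 \<le> r"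
    and R: "\<And>i j. i < n \<Longrightarrow> j < n \<Longrightarrow> (i, j) \<notin> F \<Longrightarrow> \<bar>recip_gap_mat n p lam $$ (i, j)\<bar> \<le> r"
    and \<mu>: "eigenvalue (J_mat n p lam X L) \<mu>"
  shows "cmod \<mu> \<le> spectral_norm (L_mat n L) * r
    + (\<Sum>(l, m)\<in>F. 1 / \<bar>lam l - lam m\<bar> *
        frobenius_norm (L (symmetrize n (outer (col X l) (col X m)))))"
proof -
  let ?N = "half_dim n"
  let ?T = "T_mat n" and ?L = "L_mat n L" and ?D = "D_mat n p lam"
  let ?K = "kronecker (map_mat cnj X) X" and ?K' = "kronecker (transpose_mat X) (mat_adjoint X)"
  let ?R = "recip_gap_mat n p lam"
  have Xc: "X \<in> carrier_mat n n" and XX: "mat_adjoint X * X = 1\<^sub>m n" "X * mat_adjoint X = 1\<^sub>m n"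
    using X by (auto simp: unitary_mat_def)
  note T = T_mat_carrier[of n] and Lc = L_mat_carrier[of n L] and D = D_mat_carrier[of n p lam]
  have K: "?K \<in> carrier_mat (n * n) (n * n)" and K': "?K' \<in> carrier_mat (n * n) (n * n)"
    using Xc by (auto intro!: kronecker_carrier)
  have J: "J_mat n p lam X L \<in> carrier_mat ?N ?N"
    unfolding J_mat_def using T Lc D K K' by (intro uminus_carrier_mat mult_carrier_mat)
  define M where "M = ?L * ?T * ?K"
  have M: "M \<in> carrier_mat (n * n) (n * n)"
    unfolding M_def using T Lc K by (intro mult_carrier_mat)
  have adj: "transpose_mat (map_mat cnj X) = mat_adjoint X"
    using Xc by (intro eq_matI) auto
  \<comment> \<open>The exact formula is for the matrix units at positions in \<open>F\<close>, the
    norm bound for the remainder.\<close>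
  have M_mult: "M *\<^sub>v vectorize V = vectorize (L (symmetrize n (X * V * mat_adjoint X)))"
    and M_norm: "norm2_vec (M *\<^sub>v vectorize V) \<le> spectral_norm ?L * frobenius_norm V"
    if V: "V \<in> carrier_mat n n" for V
  proof -
    have XVX: "X * V * mat_adjoint X \<in> carrier_mat n n"
      using Xc V by auto
    have "M *\<^sub>v vectorize V = ?L *\<^sub>v (?T *\<^sub>v (?K *\<^sub>v vectorize V))"
      unfolding M_def using T Lc K vectorize_carrier[OF V] by (simp add: assoc_mult_mat_vec[of _ "n * n" _ _ "n * n"]
          assoc_mult_mat_vec[of _ "n * n" ?N _ "n * n"] mult_mat_vec_carrier)
    also have "?K *\<^sub>v vectorize V = vectorize (X * V * mat_adjoint X)"
      using Xc V adj by (subst kronecker_mult_vectorize[of _ n n _ n n]) auto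
    also have "?T *\<^sub>v \<dots> = vech (X * V * mat_adjoint X)"
      by (rule T_mat_mult_vectorize[OF XVX])
    finally have M_vech: "M *\<^sub>v vectorize V = ?L *\<^sub>v vech (X * V * mat_adjoint X)" .
    then show "M *\<^sub>v vectorize V = vectorize (L (symmetrize n (X * V * mat_adjoint X)))"
      by (simp add: L_mat_mult_vech[OF L XVX])
    have "norm2_vec (M *\<^sub>v vectorize V) \<le> spectral_norm ?L * norm2_vec (vech (X * V * mat_adjoint X))"
      unfolding M_vech by (rule norm2_vec_mult_mat_le_spectral[OF Lc vech_carrier[OF XVX]])
    also have "\<dots> \<le> spectral_norm ?L * frobenius_norm V"
      using norm2_vec_vech_le[of "X * V * mat_adjoint X"] frobenius_norm_unitary_conj[OF Xc XX(1) V]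
      by (intro mult_left_mono spectral_norm_nonneg) simp
    finally show "norm2_vec (M *\<^sub>v vectorize V) \<le> spectral_norm ?L * frobenius_norm V" .
  qed
  show ?thesis
  proof (cases "\<mu> = 0")
    \<comment> \<open>Cyclic permutation preserves only nonzero eigenvalues, but for
      \<open>\<mu> = 0\<close> nonnegativity of the bound suffices.\<close>
    case True
    then show ?thesis
      using r spectral_norm_nonneg[of ?L] by (auto intro!: add_nonneg_nonneg sum_nonneg)
  next
    case False
    obtain v where v: "v \<in> carrier_vec ?N" "v \<noteq> 0\<^sub>v ?N" "J_mat n p lam X L *\<^sub>v v = \<mu> \<cdot>\<^sub>v v"
      using \<mu> J by (auto simp: eigenvalue_def eigenvector_def)
    define w where "w = ?L *\<^sub>v v"
    have w: "w \<in> carrier_vec (n * n)"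
      unfolding w_def using Lc v by auto
    obtain W where W: "W \<in> carrier_mat n n" "w = vectorize W"
      by (rule vectorize_surj[OF w])
    \<comment> \<open>\<open>V\<close> represents K^H w, and \<open>Y\<close> below represents D K^H
      w.\<close>
    define V where "V = mat_adjoint X * W * X"
    have V: "V \<in> carrier_mat n n" using Xc W by (auto simp: V_def)
    define Y where "Y = mat n n (\<lambda>ij. complex_of_real (?R $$ ij) * V $$ ij)"
    have Y: "Y \<in> carrier_mat n n" by (simp add: Y_def)
    have V_norm: "frobenius_norm V = frobenius_norm W"
      using frobenius_norm_unitary_conj[of "mat_adjoint X" n W] Xc XX W by (simp add: V_def)
    have DK: "?D *\<^sub>v (?K' *\<^sub>v w) = vectorize Y"
      unfolding W(2) using Xc W(1) V
      by (subst kronecker_mult_vectorize[of _ n n _ n n])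
        (auto simp: Y_def D_mat_mult_vectorize V_def)
    have "J_mat n p lam X L *\<^sub>v v = - (?T *\<^sub>v (?K *\<^sub>v (?D *\<^sub>v (?K' *\<^sub>v w))))"
    proof -
      have "J_mat n p lam X L *\<^sub>v v = - ((?T * ?K * ?D * ?K' * ?L) *\<^sub>v v)"
        unfolding J_mat_def using T K D K' Lc v by (intro uminus_mult_mat_vec) auto
      also have "(?T * ?K * ?D * ?K' * ?L) *\<^sub>v v = (?T * ?K * ?D * ?K') *\<^sub>v w"
        unfolding w_def using T K D K' Lc v by (intro assoc_mult_mat_vec) (auto intro!: mult_carrier_mat)
      also have "\<dots> = (?T * ?K * ?D) *\<^sub>v (?K' *\<^sub>v w)"
        using T K D K' w by (intro assoc_mult_mat_vec) (auto intro!: mult_carrier_mat)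
      also have "\<dots> = (?T * ?K) *\<^sub>v (?D *\<^sub>v (?K' *\<^sub>v w))"
        using T K D K' w by (intro assoc_mult_mat_vec) (auto intro!: mult_carrier_mat)
      also have "\<dots> = ?T *\<^sub>v (?K *\<^sub>v (?D *\<^sub>v (?K' *\<^sub>v w)))"
        using T K D K' w by (intro assoc_mult_mat_vec) (auto intro!: mult_carrier_mat)
      finally show ?thesis .
    qed
    then have v_eq: "\<mu> \<cdot>\<^sub>v v = - (?T *\<^sub>v (?K *\<^sub>v vectorize Y))"
      using v(3) DK by simp
    have "\<mu> \<cdot>\<^sub>v w = ?L *\<^sub>v (\<mu> \<cdot>\<^sub>v v)"
      unfolding w_def using Lc v by (simp add: mult_mat_vec)
    also have "\<dots> = - (M *\<^sub>v vectorize Y)"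
      unfolding v_eq M_def using T K Lc vectorize_carrier[OF Y]
      by (simp add: mult_mat_vec_uminus[of _ "n * n" ?N] assoc_mult_mat_vec[of _ "n * n" _ _ "n * n"]
          assoc_mult_mat_vec[of _ "n * n" ?N _ "n * n"] mult_mat_vec_carrier)
    finally have eig: "\<mu> \<cdot>\<^sub>v w = - (M *\<^sub>v vectorize Y)" .
    \<comment> \<open>\<open>J_mat\<close> applies L' first, so \<open>w = 0\<close> would give
      \<mu> v = 0, although neither factor vanishes.\<close>
    have "w \<noteq> 0\<^sub>v (n * n)"
    proof
      assume "w = 0\<^sub>v (n * n)"
      moreover have "B *\<^sub>v 0\<^sub>v k = 0\<^sub>v m" if "B \<in> carrier_mat m k" for B :: "complex mat" and m k
        using that by (intro eq_vecI) auto
      ultimately have "\<mu> \<cdot>\<^sub>v v = 0\<^sub>v ?N"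
        using v_eq DK T K D K' by (metis uminus_zero_vec)
      with False v(1,2) show False by (auto simp: vec_eq_iff)
    qed
    then have w_pos: "0 < frobenius_norm W"
      using norm2_vec_pos[OF w] by (simp add: W(2) norm2_vec_vectorize)
    let ?Z = "mat n n (\<lambda>ij. if ij \<in> F then 0 else Y $$ ij)"
    let ?c = "\<lambda>l m. frobenius_norm (L (symmetrize n (outer (col X l) (col X m))))"
    \<comment> \<open>Entries in \<open>F\<close> are zero, and the others are those of
      \<open>V\<close> scaled by at most \<open>r\<close>.\<close>
    have Z: "frobenius_norm ?Z \<le> r * frobenius_norm W"
      unfolding V_norm[symmetric] using V r R
      by (intro frobenius_norm_scaled_mono) (auto simp: Y_def norm_mult intro!: mult_right_mono)
    have E: "norm2_vec (M *\<^sub>v vectorize (outer (unit_vec n l) (unit_vec n m))) = ?c l m"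
      if "l < n" "m < n" for l m
    proof -
      have "X *\<^sub>v unit_vec n l = col X l" "X *\<^sub>v unit_vec n m = col X m"
        using Xc that by (auto intro!: eq_vecI)
      moreover have "outer (unit_vec n l) (unit_vec n m) \<in> carrier_mat n n"
        by (simp add: outer_def)
      ultimately show ?thesis
        by (simp add: M_mult outer_sandwich[OF Xc Xc] norm2_vec_vectorize)
    qed
    \<comment> \<open>A single entry of \<open>V\<close> is bounded by the whole Frobenius norm,
      which equals that of \<open>W\<close>.\<close>
    have Y_le: "cmod (Y $$ (l, m)) \<le> 1 / \<bar>lam l - lam m\<bar> * frobenius_norm W" if "l < n" "m < n" for l m
      unfolding V_norm[symmetric] using that V cmod_entry_le_frobenius_norm[of l V m]
      by (auto simp: Y_def norm_mult simp del: times_divide_eq_left intro!: mult_mono abs_recip_gap_le)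
    have "cmod \<mu> * frobenius_norm W = norm2_vec (M *\<^sub>v vectorize Y)"
      using arg_cong[OF eig, of norm2_vec]
      by (simp add: norm2_vec_smult norm2_vec_uminus W(2) norm2_vec_vectorize)
    also have "\<dots> \<le> norm2_vec (M *\<^sub>v vectorize ?Z)
      + (\<Sum>(l, m)\<in>F. cmod (Y $$ (l, m)) *
           norm2_vec (M *\<^sub>v vectorize (outer (unit_vec n l) (unit_vec n m))))"
      by (rule norm2_vec_mult_split[OF M Y F])
    also have "\<dots> \<le> spectral_norm ?L * (r * frobenius_norm W)
      + (\<Sum>(l, m)\<in>F. 1 / \<bar>lam l - lam m\<bar> * frobenius_norm W * ?c l m)"
    proof (rule add_mono)
      have "norm2_vec (M *\<^sub>v vectorize ?Z) \<le> spectral_norm ?L * frobenius_norm ?Z"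
        by (rule M_norm) simp
      also have "\<dots> \<le> spectral_norm ?L * (r * frobenius_norm W)"
        using Z by (intro mult_left_mono spectral_norm_nonneg)
      finally show "norm2_vec (M *\<^sub>v vectorize ?Z) \<le> spectral_norm ?L * (r * frobenius_norm W)" .
    next
      show "(\<Sum>(l, m)\<in>F. cmod (Y $$ (l, m)) *
           norm2_vec (M *\<^sub>v vectorize (outer (unit_vec n l) (unit_vec n m))))
         \<le> (\<Sum>(l, m)\<in>F. 1 / \<bar>lam l - lam m\<bar> * frobenius_norm W * ?c l m)"
      proof (intro sum_mono, clarify)
        fix l m assume "(l, m) \<in> F"
        then have "l < n" "m < n" using F by auto
        then show "cmod (Y $$ (l, m)) *
           norm2_vec (M *\<^sub>v vectorize (outer (unit_vec n l) (unit_vec n m)))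
           \<le> 1 / \<bar>lam l - lam m\<bar> * frobenius_norm W * ?c l m"
          using Y_le E by (metis frobenius_norm_nonneg mult_right_mono)
      qed
    qed
    also have "\<dots> = (spectral_norm ?L * r + (\<Sum>(l, m)\<in>F. 1 / \<bar>lam l - lam m\<bar> * ?c l m))
        * frobenius_norm W"
      by (simp add: distrib_left distrib_right sum_distrib_left sum_distrib_right case_prod_unfold ac_simps)
    finally show ?thesis using w_pos by simp
  qed
qed

theorem theorem3p1:
  fixes n p q :: nat
    and A0 X X1 X2 :: "complex mat"
    and A L :: "complex mat \<Rightarrow> complex mat"
    and lam :: "nat \<Rightarrow> real"
    and \<Omega> :: "(nat \<times> nat) set"
  assumes "1 \<le> p" and "p < n"
    and "A \<in> hermitian_mats n \<rightarrow> hermitian_mats n"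
    and "A0 \<in> hermitian_mats n"
    and "linear_on_mats n L"
    and "\<And>P. P \<in> hermitian_mats n \<Longrightarrow> A P = A0 + L P"
    and "nepv_solution n p A X1 lam"
    and "\<And>i j. i \<le> j \<Longrightarrow> j < n \<Longrightarrow> lam i \<le> lam j"
    and "char_poly (A (X1 * mat_adjoint X1)) = (\<Prod>i<n. [:- complex_of_real (lam i), 1:])"
    and "lam p - lam (p - 1) \<noteq> 0"
    and "X2 \<in> carrier_mat n (n - p)"
    and "X = mat_of_cols n (cols X1 @ cols X2)"
    and "unitary_mat n X"
    and "A (X1 * mat_adjoint X1) * X = X * real_diag n lam"
    and "q \<le> p * (n - p)"
    and "smallest_gap_set n p lam q \<Omega>"
  shows "ereal (spectral_radius (J_mat n p lam X L))
    \<le> ereal (spectral_norm (L_mat n L)) / gap n p lam (q + 1)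
      + ereal (\<Sum>(l, m)\<in>\<Omega>. 1 / \<bar>lam l - lam m\<bar> *
                 frobenius_norm (L (symmetrize n (outer (col X l) (col X m)))))"
proof -
  \<comment> \<open>By monotonicity the one gap between \<open>lam (p - 1)\<close> and
    \<open>lam p\<close> separates all pairs.\<close>
  have ne: "lam i \<noteq> lam k" if "(i, k) \<in> gap_pairs n p" for i k
  proof -
    have ik: "i \<le> p - 1" "p \<le> k" "k < n" using that by (auto simp: gap_pairs_def)
    have "lam i \<le> lam (p - 1)" "lam (p - 1) \<le> lam p" "lam p \<le> lam k"
      using ik assms(1,2) by (auto intro!: assms(8))
    with assms(10) show ?thesis by linarith
  qed
  obtain r where r: "0 \<le> r" "\<And>s. ereal s / gap n p lam (q + 1) = ereal (s * r)"
    "\<And>i j. i < n \<Longrightarrow> j < n \<Longrightarrow> (i, j) \<notin> \<Omega> \<Longrightarrow> \<bar>recip_gap_mat n p lam $$ (i, j)\<bar> \<le> r"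
    using recip_gap_bound_outside[OF assms(16) ne] by blast
  have \<Omega>: "\<Omega> \<subseteq> {..<n} \<times> {..<n}"
    using smallest_gap_set_subset[OF assms(16,15)] assms(2) by simp
  have J: "J_mat n p lam X L \<in> carrier_mat (half_dim n) (half_dim n)"
    using T_mat_carrier[of n] L_mat_carrier[of n L] by (intro carrier_matI) (auto simp: J_mat_def)
  have "0 < half_dim n"
    using assms(2) by (simp add: half_dim_def div_greater_zero_iff) (cases n; simp)
  \<comment> \<open>As the dimension is positive, the spectral radius is attained at an
    eigenvalue.\<close>
  then obtain \<mu> where "eigenvalue (J_mat n p lam X L) \<mu>" "spectral_radius (J_mat n p lam X L) = cmod \<mu>"
    using spectral_radius_mem_max(1)[OF J] by (auto simp: spectrum_def)
  with J_mat_eigenvalue_bound[OF assms(5,13) \<Omega> r(1,3)] show ?thesis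
    using r(2)[of "spectral_norm (L_mat n L)"] by simp
qed

end
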